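(* Let $0<\alpha<1$, and let $c\in(0,1)$ be a prespecified constant. For all $0<a<1$, all $F$, and all positive integers $m$, $$\mathsf P_{a,F}\{H^m\in\mathcal U_\alpha(P^m)\}\ge1-\alpha,$$ $$\mathsf P_{a,F}\{M_0\in\mathcal M_\alpha(P^m)\}\ge1-\alpha,$$ $$\mathsf P_{a,F}\{\Gamma(\cdot,H^m,P^m)\in\mathcal G_\alpha(P^m)\}\ge1-\alpha,$$ $$\mathsf P_{a,F}\{\Gamma(T_c)\le c\}\ge1-\alpha,$$ where $$T_c=\sup\{t:\Gamma(t,h^m,P^m)\le c\text{ for all }h^m\in\mathcal U_\alpha(P^m)\}.$$ In particular, $$\overline\Gamma(t)=\sup\{\Gamma(t):\Gamma\in\mathcal G_\alpha(P^m)\}$$ is a $1-\alpha$ confidence envelope for $\Gamma$, and $T_c$ is a $1-\alpha$ rate ceiling confidence threshold with ceiling $c$. In fact, $$\inf_{a,F}\mathsf P_{a,F}\{\Gamma(t)\le\overline\Gamma(t)\text{ for all }t\}\ge1-\alpha.$$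
   Context: Model: under $\mathsf P_{a,F}$ the pairs $(P_i,H_i)$, $i=1,\dots,m$, are i.i.d. with $H_i\sim\text{Bernoulli}(a)$; conditionally on $H_i=0$, $P_i$ is Uniform$(0,1)$; conditionally on $H_i=1$, $P_i$ has distribution function $F$ on $[0,1]$, where $F(t)\ge t$ for all $t$. Write $P^m=(P_1,\dots,P_m)$, $H^m=(H_1,\dots,H_m)$ and $M_0=\sum_{i=1}^m(1-H_i)$. For $t\in[0,1]$, $h^m\in\{0,1\}^m$ and $p^m\in[0,1]^m$, define $$\Gamma(t,h^m,p^m)=\frac{\sum_{i=1}^m\mathbf 1\{p_i\le t\}(1-h_i)}{\sum_{i=1}^m\mathbf 1\{p_i\le t\}+\mathbf 1\{\text{all }p_i>t\}};$$ the FDP (false discovery proportion) process is $\Gamma(t)=\Gamma(t,H^m,P^m)$, and for a random threshold $T=T(P^m)$, $\Gamma(T)=\Gamma(T(P^m),H^m,P^m)$. For each $k$, $\varphi_k(v_1,\dots,v_k)\in\{0,1\}$ is a given nonrandomized level $\alpha$ test ($1$ = reject) of the null hypothesis that $V_1,\dots,V_k$ are drawn i.i.d. from a Uniform$(0,1)$ distribution; for $k=0$ the test does not reject. Let $p_0^m(h^m)=(p_i:h_i=0,\ 1\le i\le m)$, $m_0(h^m)=\sum_{i=1}^m(1-h_i)$, and $$\mathcal U_\alpha(p^m)=\{h^m\in\{0,1\}^m:\varphi_{m_0(h^m)}(p_0^m(h^m))=0\}$$ (so $\mathcal U_\alpha$ always contains $(1,\dots,1)$), $$\mathcal G_\alpha(p^m)=\{\Gamma(\cdot,h^m,p^m):h^m\in\mathcal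 U_\alpha(p^m)\},\qquad \mathcal M_\alpha(p^m)=\{m_0(h^m):h^m\in\mathcal U_\alpha(p^m)\}.$$ A $1-\alpha$ confidence envelope for $\Gamma$ is a random function $\overline\Gamma$ on $[0,1]$ with $\mathsf P\{\Gamma(t)\le\overline\Gamma(t)\text{ for all }t\}\ge1-\alpha$. A threshold $T$ is a $1-\alpha$ confidence threshold if there is a statistic $Z$ with $\mathsf P\{\Gamma(T)\le Z\}\ge1-\alpha$; it is a rate ceiling confidence threshold with ceiling $c$ when $Z$ is the prespecified constant $c$.
   Formalization: Γ(T_c) ≤ c is false at the supremum itself (m=1, test never rejects: probability a). Proved instead, also for the rate ceiling claim: the left limit Γ(T_c−) ≤ c; and Γ(t) ≤ c for all t in the set whose supremum is T_c, each with probability at least 1−α. *)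

theory Defs
  imports "HOL-Probability.Probability"
begin

section \<open>The two-groups model\<close>

text \<open>
  Distribution functions of the alternative p-values, as functions on the whole real line:
  supported in the unit interval (an atom at 0 is allowed) and stochastically smaller than uniform.
\<close>

definition alternative_cdf :: "(real \<Rightarrow> real) \<Rightarrow> bool" where
  "alternative_cdf F \<longleftrightarrow>
     mono F \<and> (\<forall>t. continuous (at_right t) F) \<and>
     (\<forall>t<0. F t = 0) \<and> (\<forall>t\<ge>1. F t = 1) \<and> (\<forall>t\<in>{0..1}. t \<le> F t)"

text \<open>
  Truth values encode the hypothesis indicators (\<open>H i \<omega>\<close> means that the \<open>i\<close>-th
  null hypothesis is false).  For an event \<open>A\<close> of positive probability,
  \<open>uniform_measure M A\<close> is the conditional probability measure given \<open>A\<close>.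
\<close>

definition two_groups_model ::
    "'w measure \<Rightarrow> nat \<Rightarrow> real \<Rightarrow> (real \<Rightarrow> real) \<Rightarrow> (nat \<Rightarrow> 'w \<Rightarrow> real) \<Rightarrow> (nat \<Rightarrow> 'w \<Rightarrow> bool) \<Rightarrow> bool" where
  "two_groups_model M m a F P H \<longleftrightarrow>
     prob_space M \<and>
     prob_space.indep_vars M (\<lambda>_. borel \<Otimes>\<^sub>M count_space UNIV) (\<lambda>i \<omega>. (P i \<omega>, H i \<omega>)) {1..m} \<and>
     (\<forall>i\<in>{1..m}.
        distr M (count_space UNIV) (H i) = measure_pmf (bernoulli_pmf a) \<and>
        distr (uniform_measure M {\<omega> \<in> space M. \<not> H i \<omega>}) borel (P i)
          = uniform_measure lborel {0<..<1} \<and>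
        cdf (distr (uniform_measure M {\<omega> \<in> space M. H i \<omega>}) borel (P i)) = F)"

definition p_vec :: "nat \<Rightarrow> (nat \<Rightarrow> 'w \<Rightarrow> real) \<Rightarrow> 'w \<Rightarrow> (nat \<Rightarrow> real)" where
  "p_vec m P \<omega> = (\<lambda>i\<in>{1..m}. P i \<omega>)"

definition h_vec :: "nat \<Rightarrow> (nat \<Rightarrow> 'w \<Rightarrow> bool) \<Rightarrow> 'w \<Rightarrow> (nat \<Rightarrow> bool)" where
  "h_vec m H \<omega> = (\<lambda>i\<in>{1..m}. H i \<omega>)"


section \<open>The false discovery proportion\<close>

definition fdp :: "nat \<Rightarrow> real \<Rightarrow> (nat \<Rightarrow> bool) \<Rightarrow> (nat \<Rightarrow> real) \<Rightarrow> real" where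
  "fdp m t h p =
     (\<Sum>i=1..m. of_bool (p i \<le> t) * (1 - of_bool (h i)))
     / ((\<Sum>i=1..m. of_bool (p i \<le> t)) + of_bool (\<forall>i\<in>{1..m}. p i > t))"

text \<open>
  The left limit \<open>\<Gamma>(t-)\<close> of the FDP process in \<open>t\<close>, that is, the FDP of the procedure
  that rejects the p-values strictly below \<open>t\<close>.
\<close>

definition fdp_left :: "nat \<Rightarrow> real \<Rightarrow> (nat \<Rightarrow> bool) \<Rightarrow> (nat \<Rightarrow> real) \<Rightarrow> real" where
  "fdp_left m t h p =
     (\<Sum>i=1..m. of_bool (p i < t) * (1 - of_bool (h i)))
     / ((\<Sum>i=1..m. of_bool (p i < t)) + of_bool (\<forall>i\<in>{1..m}. p i \<ge> t))"

lemma tendsto_fdp_left: "((\<lambda>s. fdp m s h p) \<longlongrightarrow> fdp_left m t h p) (at_left t)"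
proof -
  have "\<forall>\<^sub>F s in at_left t. (p i \<le> s) = (p i < t)" for i
  proof (cases "p i < t")
    case True
    then have "\<forall>\<^sub>F s in at_left t. p i < s"
      by (intro eventually_at_left_real[THEN eventually_mono]) auto
    then show ?thesis
      by eventually_elim (use True in auto)
  next
    case False
    then show ?thesis
      by (auto simp: eventually_at_filter)
  qed
  then have "\<forall>\<^sub>F s in at_left t. \<forall>i\<in>{1..m}. (p i \<le> s) = (p i < t)"
    by (intro eventually_ball_finite) auto
  then have "\<forall>\<^sub>F s in at_left t. fdp m s h p = fdp_left m t h p"
  proof eventually_elim
    case (elim s)
    have "(\<forall>i\<in>{1..m}. p i > s) = (\<forall>i\<in>{1..m}. p i \<ge> t)"
      using elim by (meson not_le)
    moreover have "(\<Sum>i=1..m. of_bool (p i \<le> s) * (1 - of_bool (h i)))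
        = (\<Sum>i=1..m. of_bool (p i < t) * (1 - of_bool (h i)) :: real)"
      using elim by (intro sum.cong) auto
    moreover have "(\<Sum>i=1..m. of_bool (p i \<le> s)) = (\<Sum>i=1..m. of_bool (p i < t) :: real)"
      using elim by (intro sum.cong) auto
    ultimately show ?case
      unfolding fdp_def fdp_left_def by simp
  qed
  then show ?thesis
    by (rule tendsto_eventually)
qed


section \<open>Tests of uniformity and the confidence sets\<close>

text \<open>
  \<open>\<psi>\<close> is the (measurable) rejection region of a level \<open>\<alpha>\<close> test for \<open>k\<close> observations,
  listed in order.
\<close>

definition uniformity_test :: "real \<Rightarrow> nat \<Rightarrow> (real list \<Rightarrow> bool) \<Rightarrow> bool" where
  "uniformity_test \<alpha> k \<psi> \<longleftrightarrow>
     {v \<in> space (\<Pi>\<^sub>M i\<in>{..<k}. borel). \<psi> (map v [0..<k])} \<in> sets (\<Pi>\<^sub>M i\<in>{..<k}. borel) \<and>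
     measure (\<Pi>\<^sub>M i\<in>{..<k}. uniform_measure lborel {0<..<1})
       {v \<in> space (\<Pi>\<^sub>M i\<in>{..<k}. borel). \<psi> (map v [0..<k])} \<le> \<alpha>"

definition m0 :: "nat \<Rightarrow> (nat \<Rightarrow> bool) \<Rightarrow> nat" where
  "m0 m h = (\<Sum>i=1..m. 1 - of_bool (h i))"

definition p0 :: "nat \<Rightarrow> (nat \<Rightarrow> bool) \<Rightarrow> (nat \<Rightarrow> real) \<Rightarrow> real list" where
  "p0 m h p = map p (filter (\<lambda>i. \<not> h i) [1..<Suc m])"

definition conf_indicators ::
    "(nat \<Rightarrow> real list \<Rightarrow> bool) \<Rightarrow> nat \<Rightarrow> (nat \<Rightarrow> real) \<Rightarrow> (nat \<Rightarrow> bool) set" where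
  "conf_indicators \<phi> m p = {h \<in> {1..m} \<rightarrow>\<^sub>E UNIV. \<not> \<phi> (m0 m h) (p0 m h p)}"

definition conf_fdps ::
    "(nat \<Rightarrow> real list \<Rightarrow> bool) \<Rightarrow> nat \<Rightarrow> (nat \<Rightarrow> real) \<Rightarrow> (real \<Rightarrow> real) set" where
  "conf_fdps \<phi> m p = (\<lambda>h. \<lambda>t\<in>{0..1}. fdp m t h p) ` conf_indicators \<phi> m p"

definition conf_null_counts ::
    "(nat \<Rightarrow> real list \<Rightarrow> bool) \<Rightarrow> nat \<Rightarrow> (nat \<Rightarrow> real) \<Rightarrow> nat set" where
  "conf_null_counts \<phi> m p = m0 m ` conf_indicators \<phi> m p"

definition fdp_envelope ::
    "(nat \<Rightarrow> real list \<Rightarrow> bool) \<Rightarrow> nat \<Rightarrow> (nat \<Rightarrow> real) \<Rightarrow> real \<Rightarrow> real" where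
  "fdp_envelope \<phi> m p t = (SUP g\<in>conf_fdps \<phi> m p. g t)"

definition ceiling_set ::
    "(nat \<Rightarrow> real list \<Rightarrow> bool) \<Rightarrow> nat \<Rightarrow> real \<Rightarrow> (nat \<Rightarrow> real) \<Rightarrow> real set" where
  "ceiling_set \<phi> m c p = {t\<in>{0..1}. \<forall>h\<in>conf_indicators \<phi> m p. fdp m t h p \<le> c}"

text \<open>
  The supremum is taken in the unit interval, so that of the empty set is 0.  (The set can be
  empty only if some p-value is 0.)
\<close>

definition ceiling_threshold ::
    "(nat \<Rightarrow> real list \<Rightarrow> bool) \<Rightarrow> nat \<Rightarrow> real \<Rightarrow> (nat \<Rightarrow> real) \<Rightarrow> real" where
  "ceiling_threshold \<phi> m c p = (if ceiling_set \<phi> m c p = {} then 0 else Sup (ceiling_set \<phi> m c p))"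

text \<open>
  The supremum need not belong to \<open>ceiling_set\<close>: FDP curves are right continuous step functions
  and a supremum below 1 is a jump point, where the ceiling is exceeded by some curve.
  Evaluating the FDP process itself at the supremum does not control it at all,
  as the following instance with a single p-value (and the test that never rejects) shows.
  Control holds for the process at every point of \<open>ceiling_set\<close> and for its left limit at the
  supremum.
\<close>

lemma fdp_at_ceiling_threshold_not_controlled:
  fixes p :: "nat \<Rightarrow> real"
  assumes "0 < p 1" "p 1 \<le> 1" "c < 1" "0 \<le> c"
  shows "ceiling_threshold (\<lambda>_ _. False) 1 c p = p 1"
    and "fdp 1 (p 1) (\<lambda>i\<in>{1}. False) p = 1"
proof -
  have fdp1: "fdp 1 t h p = of_bool (p 1 \<le> t \<and> \<not> h 1)" for t h
    by (auto simp: fdp_def)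
  have null: "(\<lambda>i\<in>{1}. False) \<in> conf_indicators (\<lambda>_ _. False) 1 p"
    by (auto simp: conf_indicators_def)
  have "(\<forall>h\<in>conf_indicators (\<lambda>_ _. False) 1 p. fdp 1 t h p \<le> c) \<longleftrightarrow> t < p 1" for t
  proof
    assume "\<forall>h\<in>conf_indicators (\<lambda>_ _. False) 1 p. fdp 1 t h p \<le> c"
    then have "fdp 1 t (\<lambda>i\<in>{1}. False) p \<le> c"
      using null by blast
    then show "t < p 1"
      using assms by (cases "p 1 \<le> t") (auto simp: fdp1 simp del: One_nat_def)
  next
    assume "t < p 1"
    then show "\<forall>h\<in>conf_indicators (\<lambda>_ _. False) 1 p. fdp 1 t h p \<le> c"
      using assms by (simp add: fdp1 del: One_nat_def)
  qed
  then have "ceiling_set (\<lambda>_ _. False) 1 c p = {0..<p 1}"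
    using assms by (auto simp: ceiling_set_def simp del: One_nat_def)
  then show "ceiling_threshold (\<lambda>_ _. False) 1 c p = p 1"
    using assms by (simp add: ceiling_threshold_def)
  show "fdp 1 (p 1) (\<lambda>i\<in>{1}. False) p = 1"
    by (simp add: fdp1 del: One_nat_def)
qed


section \<open>Confidence envelopes and thresholds\<close>

text \<open>\<open>\<Gamma>\<close> and \<open>\<Gamma>bar\<close> are random functions on the unit interval.\<close>

definition confidence_envelope ::
    "'w measure \<Rightarrow> real \<Rightarrow> (real \<Rightarrow> 'w \<Rightarrow> real) \<Rightarrow> (real \<Rightarrow> 'w \<Rightarrow> real) \<Rightarrow> bool" where
  "confidence_envelope M \<alpha> \<Gamma> \<Gamma>bar \<longleftrightarrow>
     (\<forall>t\<in>{0..1}. \<Gamma>bar t \<in> borel_measurable M) \<and>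
     measure M {\<omega> \<in> space M. \<forall>t\<in>{0..1}. \<Gamma> t \<omega> \<le> \<Gamma>bar t \<omega>} \<ge> 1 - \<alpha>"

text \<open>Here \<open>X\<close> is the vector of p-values, and \<open>T\<close> is a (measurable) function of it.\<close>

definition rate_ceiling_threshold ::
    "'w measure \<Rightarrow> nat \<Rightarrow> real \<Rightarrow> ('w \<Rightarrow> (nat \<Rightarrow> real)) \<Rightarrow> (real \<Rightarrow> 'w \<Rightarrow> real) \<Rightarrow>
     ((nat \<Rightarrow> real) \<Rightarrow> real) \<Rightarrow> real \<Rightarrow> bool" where
  "rate_ceiling_threshold M m \<alpha> X \<Gamma> T c \<longleftrightarrow>
     T \<in> borel_measurable (\<Pi>\<^sub>M i\<in>{1..m}. borel) \<and>
     measure M {\<omega> \<in> space M. \<Gamma> (T (X \<omega>)) \<omega> \<le> c} \<ge> 1 - \<alpha>"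

end

theory Submission
  imports Defs
begin

text \<open>
  The level of the tests carries the whole theorem: given the hypothesis indicators, the p-values
  of the true nulls are i.i.d. uniform (\<open>distr_null_pvalues_given_indicators\<close>), so the test applied
  to exactly these p-values rejects with conditional probability at most \<open>\<alpha>\<close>, whatever the number
  of true nulls is.  Hence the true indicator vector lies in the confidence set with probability at
  least \<open>1 - \<alpha>\<close> (\<open>indicators_coverage\<close>), for all \<open>a\<close> and \<open>F\<close>.  On this event every functional of the
  indicators belongs to the image of the confidence set under that functional.  All claims hold
  simultaneously there, the claim about the ceiling threshold up to a null event.

  Two points need care.  The sets of outcomes in question quantify over a continuum of thresholds,
  and their measurability rests on the fact that a curve of false discovery proportions depends on
  the threshold through the set of rejected p-values only; rational thresholds in the unit interval
  realize all these sets (\<open>rational_threshold_same_rejections\<close>).  Moreover, the left limit at the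
  ceiling threshold is controlled (\<open>fdp_left_ceiling_threshold_le\<close>) because the supremum is approached
  from the left by admissible thresholds, unless it is 1 and itself admissible, or there are no
  admissible thresholds.  These exceptional cases are harmless because almost surely no p-value is
  1 and null p-values are positive; that alternatives have no atom at 1 is where \<open>F t \<ge> t\<close> enters.
\<close>

section \<open>FDP curves as step functions of the threshold\<close>

lemma fdp_cong_rejections:
  assumes "\<And>i. i \<in> {1..m} \<Longrightarrow> p i \<le> t \<longleftrightarrow> p i \<le> s"
  shows "fdp m t h p = fdp m s h p"
proof -
  have "(\<Sum>i=1..m. of_bool (p i \<le> t) * (1 - of_bool (h i)))
      = (\<Sum>i=1..m. of_bool (p i \<le> s) * (1 - of_bool (h i)) :: real)"
    using assms by (intro sum.cong) auto
  moreover have "(\<Sum>i=1..m. of_bool (p i \<le> t)) = (\<Sum>i=1..m. of_bool (p i \<le> s) :: real)"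
    using assms by (intro sum.cong) auto
  moreover have "(\<forall>i\<in>{1..m}. p i > t) \<longleftrightarrow> (\<forall>i\<in>{1..m}. p i > s)"
    using assms by (meson not_le)
  ultimately show ?thesis
    unfolding fdp_def by simp
qed

lemma fdp_left_eq_fdp:
  assumes "\<And>i. i \<in> {1..m} \<Longrightarrow> p i < t \<longleftrightarrow> p i \<le> s"
  shows "fdp_left m t h p = fdp m s h p"
proof -
  have "(\<Sum>i=1..m. of_bool (p i < t) * (1 - of_bool (h i)))
      = (\<Sum>i=1..m. of_bool (p i \<le> s) * (1 - of_bool (h i)) :: real)"
    using assms by (intro sum.cong) auto
  moreover have "(\<Sum>i=1..m. of_bool (p i < t)) = (\<Sum>i=1..m. of_bool (p i \<le> s) :: real)"
    using assms by (intro sum.cong) auto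
  moreover have "(\<forall>i\<in>{1..m}. p i \<ge> t) \<longleftrightarrow> (\<forall>i\<in>{1..m}. p i > s)"
    using assms by (meson not_le)
  ultimately show ?thesis
    unfolding fdp_def fdp_left_def by simp
qed

text \<open>
  The set of rejected p-values stays constant immediately to the right of every threshold.  Hence
  statements about all thresholds reduce to countably many rational ones, which gives
  measurability, and below 1 the rational threshold can be taken strictly larger, which locates
  the supremum of the admissible thresholds.
\<close>

lemma rational_threshold_same_rejections:
  fixes p :: "nat \<Rightarrow> real"
  assumes "t \<in> {0..1}"
  obtains q where "q \<in> \<rat> \<inter> {0..1}" "t \<le> q" "t < 1 \<Longrightarrow> t < q"
    "\<And>i. i \<in> {1..m} \<Longrightarrow> p i \<le> t \<longleftrightarrow> p i \<le> q"
proof (cases "t = 1")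
  case True
  then show ?thesis
    by (intro that[of 1]) auto
next
  case False
  define u where "u = Min (insert 1 (p ` {i\<in>{1..m}. t < p i}))"
  have "t < u"
    using False assms by (auto simp: u_def)
  have u: "u \<le> 1" "\<And>i. i \<in> {1..m} \<Longrightarrow> t < p i \<Longrightarrow> u \<le> p i"
    by (auto simp: u_def intro: Min_le)
  obtain q where q: "q \<in> \<rat>" "t < q" "q < u"
    using Rats_dense_in_real[OF \<open>t < u\<close>] by blast
  show ?thesis
  proof (rule that[of q])
    show "q \<in> \<rat> \<inter> {0..1}" "t \<le> q" "t < q"
      using q u assms by auto
    show "p i \<le> t \<longleftrightarrow> p i \<le> q" if "i \<in> {1..m}" for i
      using u(2)[OF that] q by (cases "t < p i") auto
  qed
qed

lemma ball_threshold_iff_rational: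
  fixes p :: "nat \<Rightarrow> real"
  assumes "\<And>t s. t \<in> {0..1} \<Longrightarrow> s \<in> {0..1} \<Longrightarrow>
    (\<And>i. i \<in> {1..m} \<Longrightarrow> p i \<le> t \<longleftrightarrow> p i \<le> s) \<Longrightarrow> Q t \<longleftrightarrow> Q s"
  shows "(\<forall>t\<in>{0..1}. Q t) \<longleftrightarrow> (\<forall>t\<in>\<rat> \<inter> {0..1}. Q t)"
proof (intro iffI ballI)
  fix t :: real assume *: "\<forall>t\<in>\<rat> \<inter> {0..1}. Q t" and t: "t \<in> {0..1}"
  obtain q where "q \<in> \<rat> \<inter> {0..1}" "\<And>i. i \<in> {1..m} \<Longrightarrow> p i \<le> t \<longleftrightarrow> p i \<le> q"
    using rational_threshold_same_rejections[OF t, of m p] by metis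
  then show "Q t"
    using assms[of t q] * t by auto
qed auto

section \<open>Confidence sets for the hypothesis indicators\<close>

lemma m0_eq_length: "m0 m h = length (filter (\<lambda>i. \<not> h i) [1..<Suc m])"
proof -
  have "m0 m h = (\<Sum>i\<in>{1..m}. of_bool (\<not> h i))"
    unfolding m0_def by (intro sum.cong) auto
  also have "\<dots> = card {i\<in>{1..m}. \<not> h i}"
    by (simp add: sum_of_bool_eq Int_def)
  also have "{i\<in>{1..m}. \<not> h i} = set (filter (\<lambda>i. \<not> h i) [1..<Suc m])"
    by auto
  also have "card \<dots> = length (filter (\<lambda>i. \<not> h i) [1..<Suc m])"
    by (intro distinct_card) auto
  finally show ?thesis .
qed

lemma finite_indicators [simp]: "finite ({1..m} \<rightarrow>\<^sub>E (UNIV :: bool set))" for m :: nat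
  by (intro finite_PiE) auto

lemma finite_conf_indicators [simp]: "finite (conf_indicators \<phi> m p)"
  by (rule finite_subset[OF _ finite_indicators[of m]]) (auto simp: conf_indicators_def)

text \<open>
  With no true nulls there is nothing to test, so the confidence set is never empty and the
  envelope is a supremum over a nonempty set of curves.
\<close>

lemma all_false_nulls_in_conf_indicators:
  assumes "\<not> \<phi> 0 []"
  shows "(\<lambda>i\<in>{1..m}. True) \<in> conf_indicators \<phi> m p"
proof -
  have "filter (\<lambda>i. \<not> (\<lambda>i\<in>{1..m}. True) i) [1..<Suc m] = []"
    by (auto simp: filter_empty_conv)
  then show ?thesis
    using assms by (auto simp: conf_indicators_def m0_eq_length p0_def)
qed

lemma fdp_envelope_eq:
  assumes "t \<in> {0..1}"
  shows "fdp_envelope \<phi> m p t = (SUP h\<in>conf_indicators \<phi> m p. fdp m t h p)"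
  using assms by (simp add: fdp_envelope_def conf_fdps_def image_image)

lemma fdp_envelope_cong_rejections:
  assumes "t \<in> {0..1}" "s \<in> {0..1}" "\<And>i. i \<in> {1..m} \<Longrightarrow> p i \<le> t \<longleftrightarrow> p i \<le> s"
  shows "fdp_envelope \<phi> m p t = fdp_envelope \<phi> m p s"
proof -
  have "fdp m t h p = fdp m s h p" for h
    using assms(3) by (rule fdp_cong_rejections)
  then show ?thesis
    unfolding fdp_envelope_eq[OF assms(1)] fdp_envelope_eq[OF assms(2)] by simp
qed

lemma fdp_le_fdp_envelope:
  assumes "h \<in> conf_indicators \<phi> m p" "t \<in> {0..1}"
  shows "fdp m t h p \<le> fdp_envelope \<phi> m p t"
  unfolding fdp_envelope_eq[OF assms(2)] using assms(1)
  by (intro cSUP_upper bdd_above_finite) auto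

lemma ceiling_set_cong_rejections:
  assumes "t \<in> ceiling_set \<phi> m c p" "s \<in> {0..1}" "\<And>i. i \<in> {1..m} \<Longrightarrow> p i \<le> t \<longleftrightarrow> p i \<le> s"
  shows "s \<in> ceiling_set \<phi> m c p"
proof -
  have "fdp m t h p = fdp m s h p" for h
    using assms(3) by (rule fdp_cong_rejections)
  then show ?thesis
    using assms(1,2) by (simp add: ceiling_set_def)
qed

text \<open>
  Admissibility of a threshold passes on to a rational threshold at least as large with the same
  rejections.  So countably many thresholds determine the supremum, and it is measurable.
\<close>

lemma less_ceiling_threshold_iff:
  "x < ceiling_threshold \<phi> m c p \<longleftrightarrow>
     x < 0 \<or> (\<exists>q\<in>\<rat> \<inter> {0..1}. x < q \<and> q \<in> ceiling_set \<phi> m c p)"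
proof (cases "ceiling_set \<phi> m c p = {}")
  case True
  then show ?thesis
    by (simp add: ceiling_threshold_def)
next
  case False
  have bdd: "bdd_above (ceiling_set \<phi> m c p)"
    by (rule bdd_aboveI[of _ 1]) (auto simp: ceiling_set_def)
  have "x < ceiling_threshold \<phi> m c p \<longleftrightarrow> (\<exists>t\<in>ceiling_set \<phi> m c p. x < t)"
    using False bdd by (simp add: ceiling_threshold_def less_cSup_iff)
  also have "\<dots> \<longleftrightarrow> x < 0 \<or> (\<exists>q\<in>\<rat> \<inter> {0..1}. x < q \<and> q \<in> ceiling_set \<phi> m c p)"
  proof (intro iffI; elim disjE bexE conjE)
    fix t assume t: "t \<in> ceiling_set \<phi> m c p" "x < t"
    then have "t \<in> {0..1}"
      by (simp add: ceiling_set_def)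
    from rational_threshold_same_rejections[OF this, of m p]
    obtain q where "q \<in> \<rat> \<inter> {0..1}" "t \<le> q" "\<And>i. i \<in> {1..m} \<Longrightarrow> p i \<le> t \<longleftrightarrow> p i \<le> q"
      by metis
    then show "x < 0 \<or> (\<exists>q\<in>\<rat> \<inter> {0..1}. x < q \<and> q \<in> ceiling_set \<phi> m c p)"
      using t ceiling_set_cong_rejections[OF t(1), of q] by (intro disjI2 bexI[of _ q]) auto
  next
    assume "x < 0"
    then show "\<exists>t\<in>ceiling_set \<phi> m c p. x < t"
      using False by (force simp: ceiling_set_def)
  qed auto
  finally show ?thesis .
qed

text \<open>
  Curves in the confidence set stay below the ceiling at admissible thresholds, hence so do their
  left limits at a supremum that is approached by admissible thresholds.  By right continuity, the
  supremum can itself be admissible only at 1, and there the left limit is the value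
  because no p-value equals 1.  If no threshold is admissible, then \<open>ceiling_threshold\<close> is 0, to
  the left of which there are no null p-values.
\<close>

lemma fdp_left_ceiling_threshold_le:
  assumes h: "h \<in> conf_indicators \<phi> m p" and "0 \<le> c"
    and below1: "\<And>i. i \<in> {1..m} \<Longrightarrow> p i < 1"
    and pos: "\<And>i. i \<in> {1..m} \<Longrightarrow> \<not> h i \<Longrightarrow> 0 < p i"
  shows "fdp_left m (ceiling_threshold \<phi> m c p) h p \<le> c"
proof (cases "ceiling_set \<phi> m c p = {}")
  case True
  have "(\<Sum>i=1..m. of_bool (p i < 0) * (1 - of_bool (h i))) = (0::real)"
    using pos by (intro sum.neutral) force
  then show ?thesis
    using True \<open>0 \<le> c\<close> by (simp add: ceiling_threshold_def fdp_left_def)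
next
  case False
  define T where "T = Sup (ceiling_set \<phi> m c p)"
  have bdd: "bdd_above (ceiling_set \<phi> m c p)"
    by (rule bdd_aboveI[of _ 1]) (auto simp: ceiling_set_def)
  have le: "fdp m s h p \<le> c" if "s \<in> ceiling_set \<phi> m c p" for s
    using that h by (simp add: ceiling_set_def)
  have "fdp_left m T h p \<le> c"
  proof (cases "T \<in> ceiling_set \<phi> m c p")
    case True
    then have "T \<in> {0..1}"
      by (simp add: ceiling_set_def)
    obtain q where q: "q \<in> \<rat> \<inter> {0..1}" "T < 1 \<Longrightarrow> T < q"
      "\<And>i. i \<in> {1..m} \<Longrightarrow> p i \<le> T \<longleftrightarrow> p i \<le> q"
      using rational_threshold_same_rejections[OF \<open>T \<in> {0..1}\<close>, of m p] by metis
    have "q \<in> ceiling_set \<phi> m c p"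
      using ceiling_set_cong_rejections[OF True] q by auto
    then have "q \<le> T"
      unfolding T_def using bdd by (rule cSup_upper)
    then have "T = 1"
      using q(2) \<open>T \<in> {0..1}\<close> by force
    then have "fdp_left m T h p = fdp m T h p"
      using below1 by (intro fdp_left_eq_fdp) (auto intro: less_imp_le)
    then show ?thesis
      using le[OF True] by simp
  next
    case notin: False
    show ?thesis
    proof (rule ccontr)
      assume "\<not> fdp_left m T h p \<le> c"
      then have "\<forall>\<^sub>F s in at_left T. c < fdp m s h p"
        by (intro order_tendstoD(1)[OF tendsto_fdp_left]) simp
      then obtain b where b: "b < T" "\<And>s. b < s \<Longrightarrow> s < T \<Longrightarrow> c < fdp m s h p"
        unfolding eventually_at_left_field by blast
      obtain s where s: "s \<in> ceiling_set \<phi> m c p" "b < s"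
        using b(1) less_cSup_iff[OF False bdd] by (auto simp: T_def)
      have "s < T"
        using cSup_upper[OF s(1) bdd] s(1) notin by (auto simp: T_def less_le)
      then show False
        using b(2)[OF s(2)] le[OF s(1)] by simp
    qed
  qed
  then show ?thesis
    using False by (simp add: ceiling_threshold_def T_def)
qed

section \<open>Measurability of the confidence sets\<close>

abbreviation pvalue_space :: "nat \<Rightarrow> (nat \<Rightarrow> real) measure" where
  "pvalue_space m \<equiv> \<Pi>\<^sub>M i\<in>{1..m}. borel"

lemma pred_pvalue_le_less:
  assumes [measurable]: "T \<in> borel_measurable (pvalue_space m)" and "i \<in> {1..m}"
  shows "Measurable.pred (pvalue_space m) (\<lambda>p. p i \<le> T p)"
    and "Measurable.pred (pvalue_space m) (\<lambda>p. T p < p i)"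
    and "Measurable.pred (pvalue_space m) (\<lambda>p. p i < T p)"
    and "Measurable.pred (pvalue_space m) (\<lambda>p. T p \<le> p i)"
proof -
  have "(\<lambda>p. p i) \<in> borel_measurable (pvalue_space m)"
    using assms(2) by (rule measurable_component_singleton)
  show "Measurable.pred (pvalue_space m) (\<lambda>p. p i \<le> T p)"
    "Measurable.pred (pvalue_space m) (\<lambda>p. T p < p i)"
    "Measurable.pred (pvalue_space m) (\<lambda>p. p i < T p)"
    "Measurable.pred (pvalue_space m) (\<lambda>p. T p \<le> p i)"
    unfolding pred_def
    by (intro borel_measurable_le borel_measurable_less assms(1) \<open>(\<lambda>p. p i) \<in> _\<close>)+
qed

lemma measurable_of_bool_real:
  assumes [measurable]: "Measurable.pred M Q"
  shows "(\<lambda>x. of_bool (Q x) :: real) \<in> borel_measurable M"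
  by measurable

lemma measurable_fdp:
  assumes "T \<in> borel_measurable (pvalue_space m)"
  shows "(\<lambda>p. fdp m (T p) h p) \<in> borel_measurable (pvalue_space m)"
  unfolding fdp_def
  by (intro borel_measurable_divide borel_measurable_sum borel_measurable_add
      borel_measurable_times measurable_of_bool_real borel_measurable_const pred_intros_finite
      pred_pvalue_le_less[OF assms]) auto

lemma measurable_fdp_left:
  assumes "T \<in> borel_measurable (pvalue_space m)"
  shows "(\<lambda>p. fdp_left m (T p) h p) \<in> borel_measurable (pvalue_space m)"
  unfolding fdp_left_def
  by (intro borel_measurable_divide borel_measurable_sum borel_measurable_add
      borel_measurable_times measurable_of_bool_real borel_measurable_const pred_intros_finite
      pred_pvalue_le_less[OF assms]) auto

lemma map_nth_upt: "map (\<lambda>j\<in>{..<length l}. p (l ! j)) [0..<length l] = map p l"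
  by (intro nth_equalityI) auto

lemma pred_mem_conf_indicators:
  assumes tests: "\<forall>k>0. uniformity_test \<alpha> k (\<phi> k)" and test0: "\<not> \<phi> 0 []"
  shows "Measurable.pred (pvalue_space m) (\<lambda>p. h \<in> conf_indicators \<phi> m p)"
proof (cases "h \<in> {1..m} \<rightarrow>\<^sub>E UNIV")
  case h: True
  define l where "l = filter (\<lambda>i. \<not> h i) [1..<Suc m]"
  define k where "k = length l"
  have iff: "h \<in> conf_indicators \<phi> m p \<longleftrightarrow> \<not> \<phi> k (map p l)" for p
    using h by (simp add: conf_indicators_def m0_eq_length p0_def l_def k_def)
  show ?thesis
  proof (cases "k = 0")
    case True
    then show ?thesis
      using test0 by (simp add: iff k_def)
  next
    case False
    have l: "j < k \<Longrightarrow> l ! j \<in> {1..m}" for j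
    proof -
      have "set l \<subseteq> {1..m}"
        by (auto simp: l_def)
      then show "j < k \<Longrightarrow> l ! j \<in> {1..m}"
        unfolding k_def by (meson nth_mem subsetD)
    qed
    have "(\<lambda>p. \<lambda>j\<in>{..<k}. p (l ! j)) \<in> pvalue_space m \<rightarrow>\<^sub>M (\<Pi>\<^sub>M i\<in>{..<k}. borel)"
      by (intro measurable_restrict measurable_component_singleton) (use l in auto)
    moreover have "Measurable.pred (\<Pi>\<^sub>M i\<in>{..<k}. borel) (\<lambda>v. \<phi> k (map v [0..<k]))"
      using tests False by (simp add: uniformity_test_def pred_def)
    ultimately have "Measurable.pred (pvalue_space m) (\<lambda>p. \<phi> k (map (\<lambda>j\<in>{..<k}. p (l ! j)) [0..<k]))"
      by (rule measurable_compose)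
    then show ?thesis
      by (simp add: iff map_nth_upt k_def)
  qed
next
  case False
  then show ?thesis
    by (simp add: conf_indicators_def)
qed

context
  fixes \<phi> :: "nat \<Rightarrow> real list \<Rightarrow> bool" and m :: nat
  assumes pred_conf [measurable]:
    "\<And>h. Measurable.pred (pvalue_space m) (\<lambda>p. h \<in> conf_indicators \<phi> m p)"
begin

lemma pred_ball_conf_indicators:
  assumes [measurable]: "\<And>h. Measurable.pred (pvalue_space m) (Q h)"
  shows "Measurable.pred (pvalue_space m) (\<lambda>p. \<forall>h\<in>conf_indicators \<phi> m p. Q h p)"
proof -
  have "(\<lambda>p. \<forall>h\<in>conf_indicators \<phi> m p. Q h p)
      = (\<lambda>p. \<forall>h\<in>{1..m} \<rightarrow>\<^sub>E UNIV. h \<in> conf_indicators \<phi> m p \<longrightarrow> Q h p)"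
    by (auto simp: conf_indicators_def fun_eq_iff)
  moreover have "Measurable.pred (pvalue_space m)
      (\<lambda>p. \<forall>h\<in>{1..m} \<rightarrow>\<^sub>E UNIV. h \<in> conf_indicators \<phi> m p \<longrightarrow> Q h p)"
    by (intro pred_intros_finite finite_indicators) measurable
  ultimately show ?thesis
    by simp
qed

lemma pred_mem_ceiling_set:
  "Measurable.pred (pvalue_space m) (\<lambda>p. q \<in> ceiling_set \<phi> m c p)"
proof -
  have [measurable]: "(\<lambda>p. fdp m q h p) \<in> borel_measurable (pvalue_space m)" for h
    by (intro measurable_fdp) simp
  have [measurable]: "Measurable.pred (pvalue_space m)
      (\<lambda>p. \<forall>h\<in>conf_indicators \<phi> m p. fdp m q h p \<le> c)"
    by (intro pred_ball_conf_indicators) measurable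
  show ?thesis
    unfolding ceiling_set_def mem_Collect_eq by measurable
qed

lemma measurable_ceiling_threshold:
  "ceiling_threshold \<phi> m c \<in> borel_measurable (pvalue_space m)"
proof -
  have "Measurable.pred (pvalue_space m)
      (\<lambda>p. x < 0 \<or> (\<exists>q\<in>\<rat> \<inter> {0..1}. x < q \<and> q \<in> ceiling_set \<phi> m c p))" for x
  proof -
    have "countable (\<rat> \<inter> {0..1} :: real set)"
      using countable_rat by blast
    moreover note [measurable] = pred_mem_ceiling_set
    ultimately show ?thesis
      by (intro pred_intros_logic measurable_pred_countable) measurable
  qed
  then show ?thesis
    unfolding borel_measurable_iff_greater less_ceiling_threshold_iff pred_def by blast
qed

lemma measurable_fdp_envelope:
  assumes "\<not> \<phi> 0 []" "t \<in> {0..1}"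
  shows "(\<lambda>p. fdp_envelope \<phi> m p t) \<in> borel_measurable (pvalue_space m)"
proof -
  have [measurable]: "(\<lambda>p. fdp m t h p) \<in> borel_measurable (pvalue_space m)" for h
    by (intro measurable_fdp) simp
  have "(fdp_envelope \<phi> m p t \<le> x) \<longleftrightarrow> (\<forall>h\<in>conf_indicators \<phi> m p. fdp m t h p \<le> x)" for x p
    unfolding fdp_envelope_eq[OF assms(2)]
    using all_false_nulls_in_conf_indicators[where \<phi> = \<phi>, OF assms(1), of m p]
    by (intro cSUP_le_iff bdd_above_finite) auto
  moreover have "Measurable.pred (pvalue_space m)
      (\<lambda>p. \<forall>h\<in>conf_indicators \<phi> m p. fdp m t h p \<le> x)" for x
    by (intro pred_ball_conf_indicators) measurable
  ultimately show ?thesis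
    unfolding borel_measurable_iff_le pred_def by simp
qed

end

section \<open>Null p-values given the hypothesis indicators\<close>

abbreviation uniform01 :: "real measure" where
  "uniform01 \<equiv> uniform_measure lborel {0<..<1}"

interpretation uniform01: prob_space uniform01
  by (rule prob_space_uniform_measure) auto

lemma product_prob_space_uniform01: "product_prob_space (\<lambda>_. uniform01)"
  by unfold_locales

lemma sets_PiM_uniform01: "sets (\<Pi>\<^sub>M i\<in>I. uniform01) = sets (\<Pi>\<^sub>M i\<in>I. borel)"
  by (intro sets_PiM_cong) auto

text \<open>
  A test of uniformity is stated for observations numbered from 0.  Listing the coordinates in
  \<open>N\<close> without repetition reindexes an i.i.d. family, so the level is kept.
\<close>

lemma uniformity_test_on_coordinates:
  fixes N :: "'i set"
  assumes test: "uniformity_test \<alpha> (length l) \<psi>" and l: "distinct l" "set l = N"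
  shows "{p \<in> space (\<Pi>\<^sub>M i\<in>N. borel). \<psi> (map p l)} \<in> sets (\<Pi>\<^sub>M i\<in>N. borel)"
    and "measure (\<Pi>\<^sub>M i\<in>N. uniform01) {p \<in> space (\<Pi>\<^sub>M i\<in>N. borel). \<psi> (map p l)} \<le> \<alpha>"
proof -
  define k where "k = length l"
  define R where "R = {v \<in> space (\<Pi>\<^sub>M i\<in>{..<k}. borel :: real measure). \<psi> (map v [0..<k])}"
  let ?f = "\<lambda>p. \<lambda>j\<in>{..<k}. p (l ! j)"
  have R: "R \<in> sets (\<Pi>\<^sub>M i\<in>{..<k}. borel)" "measure (\<Pi>\<^sub>M i\<in>{..<k}. uniform01) R \<le> \<alpha>"
    using test by (simp_all add: uniformity_test_def R_def k_def)
  have nth: "inj_on (nth l) {..<k}" "nth l \<in> {..<k} \<rightarrow> N"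
    using l by (auto simp: k_def inj_on_nth)
  have f: "?f \<in> (\<Pi>\<^sub>M i\<in>N. borel) \<rightarrow>\<^sub>M (\<Pi>\<^sub>M i\<in>{..<k}. borel)"
    using nth(2) by (intro measurable_restrict measurable_component_singleton) auto
  have space_U: "space (\<Pi>\<^sub>M i\<in>N. uniform01) = space (\<Pi>\<^sub>M i\<in>N. borel)"
    using sets_PiM_uniform01 by (rule sets_eq_imp_space_eq)
  have f_U: "?f \<in> (\<Pi>\<^sub>M i\<in>N. uniform01) \<rightarrow>\<^sub>M (\<Pi>\<^sub>M i\<in>{..<k}. uniform01)"
    unfolding measurable_cong_sets[OF sets_PiM_uniform01 sets_PiM_uniform01] by (rule f)
  have preimage: "?f -` R \<inter> space (\<Pi>\<^sub>M i\<in>N. borel) = {p \<in> space (\<Pi>\<^sub>M i\<in>N. borel). \<psi> (map p l)}"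
  proof (rule set_eqI)
    fix p :: "'i \<Rightarrow> real"
    have "map (?f p) [0..<k] = map p l"
      unfolding k_def by (rule map_nth_upt)
    then show "p \<in> ?f -` R \<inter> space (\<Pi>\<^sub>M i\<in>N. borel) \<longleftrightarrow> p \<in> {p \<in> space (\<Pi>\<^sub>M i\<in>N. borel). \<psi> (map p l)}"
      using measurable_space[OF f, of p] by (simp add: R_def) blast
  qed
  show "{p \<in> space (\<Pi>\<^sub>M i\<in>N. borel). \<psi> (map p l)} \<in> sets (\<Pi>\<^sub>M i\<in>N. borel)"
    unfolding preimage[symmetric] using f R(1) by (rule measurable_sets)
  have "distr (\<Pi>\<^sub>M i\<in>N. uniform01) (\<Pi>\<^sub>M i\<in>{..<k}. uniform01) ?f = (\<Pi>\<^sub>M i\<in>{..<k}. uniform01)"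
    using uniform01.prob_space_axioms nth by (rule distr_PiM_reindex)
  then have "measure (\<Pi>\<^sub>M i\<in>{..<k}. uniform01) R
      = measure (distr (\<Pi>\<^sub>M i\<in>N. uniform01) (\<Pi>\<^sub>M i\<in>{..<k}. uniform01) ?f) R"
    by simp
  also have "\<dots> = measure (\<Pi>\<^sub>M i\<in>N. uniform01) (?f -` R \<inter> space (\<Pi>\<^sub>M i\<in>N. uniform01))"
    using R(1) by (intro measure_distr f_U) (simp add: sets_PiM_uniform01)
  finally show "measure (\<Pi>\<^sub>M i\<in>N. uniform01) {p \<in> space (\<Pi>\<^sub>M i\<in>N. borel). \<psi> (map p l)} \<le> \<alpha>"
    using R(2) by (simp only: space_U preimage)
qed

locale two_groups =
  fixes M :: "'w measure" and m :: nat and a :: real and F :: "real \<Rightarrow> real"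
    and P :: "nat \<Rightarrow> 'w \<Rightarrow> real" and H :: "nat \<Rightarrow> 'w \<Rightarrow> bool"
  assumes model: "two_groups_model M m a F P H" and a: "0 < a" "a < 1"
    and F: "alternative_cdf F" and m_pos: "m > 0"

sublocale two_groups \<subseteq> prob_space M
  using model by (simp add: two_groups_model_def)

context two_groups
begin

lemma indep: "indep_vars (\<lambda>_. borel \<Otimes>\<^sub>M count_space UNIV) (\<lambda>i \<omega>. (P i \<omega>, H i \<omega>)) {1..m}"
  using model by (simp add: two_groups_model_def)

lemma measurable_P_H:
  assumes "i \<in> {1..m}"
  shows "P i \<in> borel_measurable M" "H i \<in> M \<rightarrow>\<^sub>M count_space UNIV"
proof -
  have "(\<lambda>\<omega>. (P i \<omega>, H i \<omega>)) \<in> M \<rightarrow>\<^sub>M borel \<Otimes>\<^sub>M count_space UNIV"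
    using indep assms by (auto simp: indep_vars_def2)
  from measurable_compose[OF this measurable_fst] measurable_compose[OF this measurable_snd]
  show "P i \<in> borel_measurable M" "H i \<in> M \<rightarrow>\<^sub>M count_space UNIV"
    by simp_all
qed

lemma prob_H:
  assumes i: "i \<in> {1..m}"
  shows "prob {\<omega> \<in> space M. H i \<omega>} = a" "prob {\<omega> \<in> space M. \<not> H i \<omega>} = 1 - a"
proof -
  note [measurable] = measurable_P_H[OF i]
  have distr: "distr M (count_space UNIV) (H i) = measure_pmf (bernoulli_pmf a)"
    using model i by (simp add: two_groups_model_def)
  have "prob {\<omega> \<in> space M. H i \<omega> = b} = pmf (bernoulli_pmf a) b" for b
  proof -
    have "pmf (bernoulli_pmf a) b = measure (distr M (count_space UNIV) (H i)) {b}"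
      by (simp add: distr measure_pmf_single)
    also have "\<dots> = prob (H i -` {b} \<inter> space M)"
      by (intro measure_distr) auto
    also have "H i -` {b} \<inter> space M = {\<omega> \<in> space M. H i \<omega> = b}"
      by auto
    finally show ?thesis ..
  qed
  from this[of True] this[of False]
  show "prob {\<omega> \<in> space M. H i \<omega>} = a" "prob {\<omega> \<in> space M. \<not> H i \<omega>} = 1 - a"
    using a by simp_all
qed

lemma prob_null_and_P:
  assumes i: "i \<in> {1..m}" and [measurable]: "A \<in> sets borel"
  shows "prob {\<omega> \<in> space M. \<not> H i \<omega> \<and> P i \<omega> \<in> A} = (1 - a) * measure uniform01 A"
proof -
  note [measurable] = measurable_P_H[OF i]
  let ?E = "{\<omega> \<in> space M. \<not> H i \<omega>}"
  have E: "emeasure M ?E \<noteq> 0"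
    using prob_H(2)[OF i] a by (simp add: emeasure_eq_measure)
  have "measure uniform01 A = measure (distr (uniform_measure M ?E) borel (P i)) A"
    using model i by (simp add: two_groups_model_def)
  also have "\<dots> = measure (uniform_measure M ?E) (P i -` A \<inter> space M)"
    by (subst measure_distr) auto
  also have "\<dots> = prob (?E \<inter> (P i -` A \<inter> space M)) / prob ?E"
    using E by (intro measure_uniform_measure) auto
  also have "?E \<inter> (P i -` A \<inter> space M) = {\<omega> \<in> space M. \<not> H i \<omega> \<and> P i \<omega> \<in> A}"
    by auto
  finally show ?thesis
    using a prob_H(2)[OF i] by (simp add: field_simps)
qed

abbreviation indicators_event :: "(nat \<Rightarrow> bool) \<Rightarrow> 'w set" where
  "indicators_event h \<equiv> {\<omega> \<in> space M. \<forall>i\<in>{1..m}. H i \<omega> = h i}"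

lemma sets_indicators_event: "indicators_event h \<in> sets M"
proof -
  have "Measurable.pred M (\<lambda>\<omega>. \<forall>i\<in>{1..m}. H i \<omega> = h i)"
  proof (intro pred_intros_finite)
    fix i assume "i \<in> {1..m}"
    note [measurable] = measurable_P_H[OF this]
    show "Measurable.pred M (\<lambda>\<omega>. H i \<omega> = h i)"
      by measurable
  qed auto
  then show ?thesis
    by (simp add: pred_def)
qed

lemma prob_indicators_and_null_box:
  assumes A: "\<And>i. A i \<in> sets borel"
  shows "prob {\<omega> \<in> space M. \<forall>i\<in>{1..m}. H i \<omega> = h i \<and> (\<not> h i \<longrightarrow> P i \<omega> \<in> A i)}
    = (\<Prod>i\<in>{1..m}. if h i then a else (1 - a) * measure uniform01 (A i))"
proof -
  let ?B = "\<lambda>i. (if h i then UNIV else A i) \<times> {h i}"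
  let ?X = "\<lambda>i \<omega>. (P i \<omega>, H i \<omega>)"
  have preimage: "?X i -` ?B i \<inter> space M
      = {\<omega> \<in> space M. H i \<omega> = h i \<and> (\<not> h i \<longrightarrow> P i \<omega> \<in> A i)}" for i
    by auto
  \<comment> \<open>The index set must not be empty: the empty intersection is the universe, not the sample space.\<close>
  have ne: "1 \<in> {1..m}"
    using m_pos by simp
  have B: "?B i \<in> sets (borel \<Otimes>\<^sub>M count_space UNIV)" for i
    using A by (intro pair_measureI) auto
  have "{\<omega> \<in> space M. \<forall>i\<in>{1..m}. H i \<omega> = h i \<and> (\<not> h i \<longrightarrow> P i \<omega> \<in> A i)}
      = (\<Inter>i\<in>{1..m}. ?X i -` ?B i \<inter> space M)"
    unfolding preimage using ne by blast
  also have "prob \<dots> = (\<Prod>i\<in>{1..m}. prob (?X i -` ?B i \<inter> space M))"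
    by (rule indep_varsD[OF indep]) (use ne B in auto)
  also have "\<dots> = (\<Prod>i\<in>{1..m}. if h i then a else (1 - a) * measure uniform01 (A i))"
  proof (intro prod.cong refl)
    fix i assume i: "i \<in> {1..m}"
    show "prob (?X i -` ?B i \<inter> space M) = (if h i then a else (1 - a) * measure uniform01 (A i))"
    proof (cases "h i")
      case True
      then have "?X i -` ?B i \<inter> space M = {\<omega> \<in> space M. H i \<omega>}"
        unfolding preimage by simp
      then show ?thesis
        using True prob_H(1)[OF i] by simp
    next
      case False
      then have "?X i -` ?B i \<inter> space M = {\<omega> \<in> space M. \<not> H i \<omega> \<and> P i \<omega> \<in> A i}"
        unfolding preimage by simp
      then show ?thesis
        using False prob_null_and_P[OF i A] by simp
    qed
  qed
  finally show ?thesis .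
qed

lemma prob_indicators_event:
  "prob (indicators_event h) = (\<Prod>i\<in>{1..m}. if h i then a else 1 - a)"
proof -
  have "measure uniform01 UNIV = 1"
    using uniform01.prob_space by simp
  then show ?thesis
    using prob_indicators_and_null_box[of "\<lambda>_. UNIV" h] by (simp cong: if_cong)
qed

lemma prob_indicators_event_pos: "0 < prob (indicators_event h)"
  unfolding prob_indicators_event using a by (intro prod_pos) auto

text \<open>
  Conditionally on the hypothesis indicators, the p-values of the true nulls are i.i.d. uniform:
  by independence of the pairs \<open>(P i, H i)\<close>, the probability of a box factorizes, and each null
  contributes the conditional uniform law.
\<close>

lemma distr_null_pvalues_given_indicators:
  defines "N h \<equiv> {i\<in>{1..m}. \<not> h i}"
  shows "distr (uniform_measure M (indicators_event h)) (\<Pi>\<^sub>M i\<in>N h. borel) (\<lambda>\<omega>. \<lambda>i\<in>N h. P i \<omega>)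
    = (\<Pi>\<^sub>M i\<in>N h. uniform01)"
proof -
  interpret U: product_prob_space "\<lambda>_. uniform01"
    by (rule product_prob_space_uniform01)
  let ?E = "indicators_event h"
  have meas: "(\<lambda>\<omega>. \<lambda>i\<in>N h. P i \<omega>) \<in> M \<rightarrow>\<^sub>M (\<Pi>\<^sub>M i\<in>N h. borel)"
    by (intro measurable_restrict measurable_P_H) (auto simp: N_def)
  have E: "emeasure M ?E \<noteq> 0" "emeasure M ?E \<noteq> \<infinity>"
    using prob_indicators_event_pos[of h] by (auto simp: emeasure_eq_measure)
  interpret cond: prob_space "uniform_measure M ?E"
    using E by (rule prob_space_uniform_measure)
  have meas': "(\<lambda>\<omega>. \<lambda>i\<in>N h. P i \<omega>) \<in> uniform_measure M ?E \<rightarrow>\<^sub>M (\<Pi>\<^sub>M i\<in>N h. borel)"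
    using meas by simp
  show ?thesis
  proof (rule U.PiM_eqI)
    show "finite (N h)"
      by (simp add: N_def)
    show "sets (distr (uniform_measure M ?E) (\<Pi>\<^sub>M i\<in>N h. borel) (\<lambda>\<omega>. \<lambda>i\<in>N h. P i \<omega>))
        = sets (\<Pi>\<^sub>M i\<in>N h. uniform01)"
      by (simp cong: sets_PiM_cong)
    fix A assume A: "\<And>i. i \<in> N h \<Longrightarrow> A i \<in> sets uniform01"
    define A' where "A' i = (if i \<in> N h then A i else UNIV)" for i
    have A': "A' i \<in> sets borel" for i
      using A by (auto simp: A'_def)
    have box: "Pi\<^sub>E (N h) A \<in> sets (\<Pi>\<^sub>M i\<in>N h. borel)"
      using A by (intro sets_PiM_I_finite) (auto simp: N_def)
    have "measure (distr (uniform_measure M ?E) (\<Pi>\<^sub>M i\<in>N h. borel) (\<lambda>\<omega>. \<lambda>i\<in>N h. P i \<omega>)) (Pi\<^sub>E (N h) A)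
        = measure (uniform_measure M ?E) ((\<lambda>\<omega>. \<lambda>i\<in>N h. P i \<omega>) -` Pi\<^sub>E (N h) A \<inter> space M)"
      by (subst measure_distr[OF meas' box]) simp
    also have "\<dots> = prob (?E \<inter> ((\<lambda>\<omega>. \<lambda>i\<in>N h. P i \<omega>) -` Pi\<^sub>E (N h) A \<inter> space M)) / prob ?E"
      using E by (intro measure_uniform_measure measurable_sets[OF meas box])
    also have "?E \<inter> ((\<lambda>\<omega>. \<lambda>i\<in>N h. P i \<omega>) -` Pi\<^sub>E (N h) A \<inter> space M)
        = {\<omega> \<in> space M. \<forall>i\<in>{1..m}. H i \<omega> = h i \<and> (\<not> h i \<longrightarrow> P i \<omega> \<in> A' i)}"
      by (auto simp: A'_def N_def PiE_iff)
    also have "prob \<dots> / prob ?E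
        = (\<Prod>i\<in>{1..m}. if i \<in> N h then measure uniform01 (A i) else 1)"
      unfolding prob_indicators_and_null_box[OF A'] prob_indicators_event prod_dividef[symmetric]
      using a by (intro prod.cong) (auto simp: A'_def N_def)
    also have "\<dots> = (\<Prod>i\<in>N h. measure uniform01 (A i))"
      by (simp add: prod.If_cases N_def Int_def)
    finally have "measure (distr (uniform_measure M ?E) (\<Pi>\<^sub>M i\<in>N h. borel) (\<lambda>\<omega>. \<lambda>i\<in>N h. P i \<omega>)) (Pi\<^sub>E (N h) A)
        = (\<Prod>i\<in>N h. measure uniform01 (A i))" .
    then show "emeasure (distr (uniform_measure M ?E) (\<Pi>\<^sub>M i\<in>N h. borel) (\<lambda>\<omega>. \<lambda>i\<in>N h. P i \<omega>)) (Pi\<^sub>E (N h) A)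
        = (\<Prod>i\<in>N h. emeasure uniform01 (A i))"
      using finite_measure.emeasure_eq_measure[OF prob_space.finite_measure[OF cond.prob_space_distr[OF meas']]]
      by (simp add: uniform01.emeasure_eq_measure prod_ennreal)
  qed
qed

lemma prob_indicators_and_reject_le:
  assumes tests: "\<forall>k>0. uniformity_test \<alpha> k (\<phi> k)" and test0: "\<not> \<phi> 0 []" and "0 < \<alpha>"
  shows "prob {\<omega> \<in> indicators_event h. \<phi> (m0 m h) (p0 m h (p_vec m P \<omega>))}
    \<le> \<alpha> * prob (indicators_event h)"
proof -
  define l where "l = filter (\<lambda>i. \<not> h i) [1..<Suc m]"
  define N where "N = {i\<in>{1..m}. \<not> h i}"
  let ?E = "indicators_event h"
  let ?V = "\<lambda>\<omega>. \<lambda>i\<in>N. P i \<omega>"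
  have l: "distinct l" "set l = N"
    by (auto simp: l_def N_def)
  have m0: "m0 m h = length l"
    by (simp add: m0_eq_length l_def)
  have p0: "p0 m h (p_vec m P \<omega>) = map (?V \<omega>) l" for \<omega>
  proof -
    have "p0 m h (p_vec m P \<omega>) = map (p_vec m P \<omega>) l"
      by (simp only: p0_def l_def)
    also have "\<dots> = map (?V \<omega>) l"
      using l(2) by (intro map_cong refl) (auto simp: p_vec_def N_def)
    finally show ?thesis .
  qed
  show ?thesis
  proof (cases "l = []")
    case True
    then show ?thesis
      using test0 \<open>0 < \<alpha>\<close> by (simp add: m0 p0)
  next
    case False
    define R where "R = {p \<in> space (\<Pi>\<^sub>M i\<in>N. borel :: real measure). \<phi> (length l) (map p l)}"
    have "uniformity_test \<alpha> (length l) (\<phi> (length l))"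
      using tests False by simp
    from uniformity_test_on_coordinates[OF this l]
    have R: "R \<in> sets (\<Pi>\<^sub>M i\<in>N. borel)" "measure (\<Pi>\<^sub>M i\<in>N. uniform01) R \<le> \<alpha>"
      by (simp_all add: R_def)
    have V: "?V \<in> M \<rightarrow>\<^sub>M (\<Pi>\<^sub>M i\<in>N. borel)"
      by (intro measurable_restrict measurable_P_H) (auto simp: N_def)
    have E: "emeasure M ?E \<noteq> 0" "emeasure M ?E \<noteq> \<infinity>"
      using prob_indicators_event_pos[of h] by (auto simp: emeasure_eq_measure)
    have "{\<omega> \<in> ?E. \<phi> (m0 m h) (p0 m h (p_vec m P \<omega>))} = ?E \<inter> (?V -` R \<inter> space M)"
      using measurable_space[OF V] by (auto simp: R_def m0 p0)
    then have "prob {\<omega> \<in> ?E. \<phi> (m0 m h) (p0 m h (p_vec m P \<omega>))} / prob ?E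
        = measure (uniform_measure M ?E) (?V -` R \<inter> space M)"
      using E measurable_sets[OF V R(1)] by simp
    also have "\<dots> = measure (distr (uniform_measure M ?E) (\<Pi>\<^sub>M i\<in>N. borel) ?V) R"
      using V R(1) by (subst measure_distr) auto
    also have "\<dots> = measure (\<Pi>\<^sub>M i\<in>N. uniform01) R"
      by (simp only: N_def distr_null_pvalues_given_indicators)
    finally have "prob {\<omega> \<in> ?E. \<phi> (m0 m h) (p0 m h (p_vec m P \<omega>))} / prob ?E \<le> \<alpha>"
      using R(2) by simp
    then show ?thesis
      by (simp only: pos_divide_le_eq[OF prob_indicators_event_pos])
  qed
qed

lemma h_vec_eq_iff:
  assumes "h \<in> {1..m} \<rightarrow>\<^sub>E UNIV"
  shows "h_vec m H \<omega> = h \<longleftrightarrow> (\<forall>i\<in>{1..m}. H i \<omega> = h i)"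
  using assms by (auto simp: h_vec_def fun_eq_iff PiE_def extensional_def)

lemma h_vec_in: "h_vec m H \<omega> \<in> {1..m} \<rightarrow>\<^sub>E UNIV"
  by (simp add: h_vec_def)

lemma measurable_p_vec: "p_vec m P \<in> M \<rightarrow>\<^sub>M pvalue_space m"
  unfolding p_vec_def by (intro measurable_restrict measurable_P_H)

text \<open>
  The indicator vector takes finitely many values, so an event is measurable once its sections
  at fixed indicators are.
\<close>

lemma sets_indicators_pvalues_event:
  assumes "\<And>h. h \<in> {1..m} \<rightarrow>\<^sub>E UNIV \<Longrightarrow> Measurable.pred (pvalue_space m) (Q h)"
  shows "{\<omega> \<in> space M. Q (h_vec m H \<omega>) (p_vec m P \<omega>)} \<in> sets M"
proof -
  have "{\<omega> \<in> space M. Q (h_vec m H \<omega>) (p_vec m P \<omega>)}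
      = (\<Union>h\<in>{1..m} \<rightarrow>\<^sub>E UNIV. {\<omega> \<in> space M. h_vec m H \<omega> = h \<and> Q h (p_vec m P \<omega>)})"
    using h_vec_in by blast
  also have "\<dots> = (\<Union>h\<in>{1..m} \<rightarrow>\<^sub>E UNIV. indicators_event h \<inter> {\<omega> \<in> space M. Q h (p_vec m P \<omega>)})"
    by (intro SUP_cong refl) (auto simp only: h_vec_eq_iff)
  also have "\<dots> \<in> sets M"
  proof (intro sets.finite_UN sets.Int sets_indicators_event finite_indicators)
    fix h :: "nat \<Rightarrow> bool" assume "h \<in> {1..m} \<rightarrow>\<^sub>E UNIV"
    then show "{\<omega> \<in> space M. Q h (p_vec m P \<omega>)} \<in> sets M"
      using measurable_compose[OF measurable_p_vec assms] by (simp add: pred_def)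
  qed
  finally show ?thesis .
qed

text \<open>
  Given the indicators, the true indicator vector is excluded from the confidence set exactly when
  the test rejects the uniform null p-values, which has conditional probability at most \<open>\<alpha>\<close>.
  Averaging over the indicators gives the coverage.
\<close>

lemma indicators_coverage:
  assumes tests: "\<forall>k>0. uniformity_test \<alpha> k (\<phi> k)" and test0: "\<not> \<phi> 0 []" and "0 < \<alpha>"
  shows "1 - \<alpha> \<le> prob {\<omega> \<in> space M. h_vec m H \<omega> \<in> conf_indicators \<phi> m (p_vec m P \<omega>)}"
proof -
  let ?I = "{1..m} \<rightarrow>\<^sub>E (UNIV :: bool set)"
  let ?A = "{\<omega> \<in> space M. h_vec m H \<omega> \<in> conf_indicators \<phi> m (p_vec m P \<omega>)}"
  let ?R = "\<lambda>h. {\<omega> \<in> indicators_event h. \<phi> (m0 m h) (p0 m h (p_vec m P \<omega>))}"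
  have conf: "Measurable.pred (pvalue_space m) (\<lambda>p. h \<in> conf_indicators \<phi> m p)" for h
    using tests test0 by (rule pred_mem_conf_indicators)
  then have A: "?A \<in> sets M"
    by (rule sets_indicators_pvalues_event)
  have R_eq: "?R h = indicators_event h - {\<omega> \<in> space M. h \<in> conf_indicators \<phi> m (p_vec m P \<omega>)}"
    if "h \<in> ?I" for h
    using that by (auto simp: conf_indicators_def)
  have R: "?R h \<in> sets M" if "h \<in> ?I" for h
    unfolding R_eq[OF that] using measurable_compose[OF measurable_p_vec conf]
    by (intro sets.Diff sets_indicators_event) (simp add: pred_def)
  have "space M - ?A = (\<Union>h\<in>?I. ?R h)"
  proof (intro equalityI subsetI)
    fix \<omega> assume \<omega>: "\<omega> \<in> space M - ?A"
    then have "\<omega> \<in> ?R (h_vec m H \<omega>)"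
      using h_vec_in[of \<omega>] h_vec_eq_iff[OF h_vec_in, of \<omega> \<omega>] by (auto simp: conf_indicators_def)
    then show "\<omega> \<in> (\<Union>h\<in>?I. ?R h)"
      using h_vec_in by blast
  next
    fix \<omega> assume "\<omega> \<in> (\<Union>h\<in>?I. ?R h)"
    then obtain h where h: "h \<in> ?I" "\<omega> \<in> ?R h"
      by blast
    then have "h_vec m H \<omega> = h"
      using h_vec_eq_iff by simp
    then show "\<omega> \<in> space M - ?A"
      using h by (auto simp: conf_indicators_def)
  qed
  then have "prob (space M - ?A) \<le> (\<Sum>h\<in>?I. prob (?R h))"
    using R by (simp only:) (intro finite_measure_subadditive_finite finite_indicators, auto)
  also have "\<dots> \<le> (\<Sum>h\<in>?I. \<alpha> * prob (indicators_event h))"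
    using assms by (intro sum_mono prob_indicators_and_reject_le)
  also have "\<dots> = \<alpha> * (\<Sum>h\<in>?I. prob (indicators_event h))"
    by (rule sum_distrib_left[symmetric])
  also have "(\<Sum>h\<in>?I. prob (indicators_event h)) = prob (\<Union>h\<in>?I. indicators_event h)"
  proof (intro finite_measure_finite_Union[symmetric] finite_indicators)
    show "disjoint_family_on indicators_event ?I"
      unfolding disjoint_family_on_def
    proof (intro ballI impI equals0I)
      fix h h' \<omega> assume "h \<in> ?I" "h' \<in> ?I" "h \<noteq> h'"
        and "\<omega> \<in> indicators_event h \<inter> indicators_event h'"
      then have "h_vec m H \<omega> = h" "h_vec m H \<omega> = h'"
        using h_vec_eq_iff by blast+
      then show False
        using \<open>h \<noteq> h'\<close> by simp
    qed
    show "indicators_event ` ?I \<subseteq> sets M"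
      using sets_indicators_event by blast
  qed
  also have "(\<Union>h\<in>?I. indicators_event h) = (\<Union>h\<in>?I. {\<omega> \<in> space M. h_vec m H \<omega> = h})"
    by (intro SUP_cong refl) (auto simp only: h_vec_eq_iff)
  also have "\<dots> = space M"
    using h_vec_in by blast
  finally show ?thesis
    using A by (simp add: prob_space prob_compl)
qed

lemma AE_H_imp_of_AE_conditional:
  assumes i: "i \<in> {1..m}" and [measurable]: "Measurable.pred borel Q"
    and AE: "AE x in distr (uniform_measure M {\<omega> \<in> space M. H i \<omega> = b}) borel (P i). Q x"
  shows "AE \<omega> in M. H i \<omega> = b \<longrightarrow> Q (P i \<omega>)"
proof -
  note [measurable] = measurable_P_H[OF i]
  let ?E = "{\<omega> \<in> space M. H i \<omega> = b}"
  have E: "emeasure M ?E \<noteq> 0" "emeasure M ?E < \<infinity>"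
    using prob_H[OF i] a by (cases b; simp add: emeasure_eq_measure)+
  have "AE \<omega> in uniform_measure M ?E. Q (P i \<omega>)"
    using AE by (subst (asm) AE_distr_iff) auto
  then have "AE \<omega> in M. \<omega> \<in> ?E \<longrightarrow> Q (P i \<omega>)"
    by (simp only: AE_uniform_measure[OF E])
  then show ?thesis
    by (rule AE_mp) auto
qed

lemma AE_null_pvalue_in_unit_interval:
  assumes i: "i \<in> {1..m}"
  shows "AE \<omega> in M. \<not> H i \<omega> \<longrightarrow> 0 < P i \<omega> \<and> P i \<omega> < 1"
proof -
  have "distr (uniform_measure M {\<omega> \<in> space M. H i \<omega> = False}) borel (P i) = uniform01"
    using model i by (simp add: two_groups_model_def)
  then have "AE x in distr (uniform_measure M {\<omega> \<in> space M. H i \<omega> = False}) borel (P i).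
      0 < x \<and> x < 1"
    by (simp only:) (intro AE_uniform_measureI, auto)
  then show ?thesis
    using AE_H_imp_of_AE_conditional[OF i, of "\<lambda>x. 0 < x \<and> x < 1" False] by simp
qed

text \<open>
  Stochastic domination by the uniform law excludes an atom at 1:
  \<open>F t \<ge> t\<close> forces \<open>F t\<close> to tend to 1 as \<open>t\<close> increases to 1.
\<close>

lemma AE_alternative_pvalue_less_1:
  assumes i: "i \<in> {1..m}"
  shows "AE \<omega> in M. H i \<omega> \<longrightarrow> P i \<omega> < 1"
proof -
  note [measurable] = measurable_P_H[OF i]
  let ?E = "{\<omega> \<in> space M. H i \<omega> = True}"
  define D where "D = distr (uniform_measure M ?E) borel (P i)"
  have "emeasure M ?E \<noteq> 0" "emeasure M ?E \<noteq> \<infinity>"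
    using prob_H[OF i] a by (simp_all add: emeasure_eq_measure)
  then interpret cond: prob_space "uniform_measure M ?E"
    by (rule prob_space_uniform_measure)
  interpret D: prob_space D
    unfolding D_def by (intro cond.prob_space_distr) simp
  interpret D': finite_borel_measure D
    by unfold_locales (simp add: D_def)
  have cdf: "cdf D = F"
    using model i by (simp add: two_groups_model_def D_def)
  have "(F \<longlongrightarrow> D.prob {..<1}) (at_left 1)"
    using D'.cdf_at_left[of 1] by (simp add: cdf)
  moreover have "((\<lambda>t. t) \<longlongrightarrow> (1::real)) (at_left 1)"
    by (rule tendsto_ident_at)
  moreover have "\<forall>\<^sub>F t in at_left (1::real). t \<le> F t"
  proof -
    have "\<forall>\<^sub>F t in at_left (1::real). t \<in> {0<..<1}"
      by (rule eventually_at_left_real) simp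
    then show ?thesis
      by eventually_elim (use F in \<open>auto simp: alternative_cdf_def\<close>)
  qed
  ultimately have "1 \<le> D.prob {..<1}"
    by (intro tendsto_le[of "at_left 1" F _ "\<lambda>t. t"]) auto
  then have "D.prob {..<1} = 1"
    using D.prob_le_1[of "{..<1}"] by linarith
  then have "AE x in D. x \<in> {..<1}"
    by (rule D.AE_prob_1)
  then have "AE x in D. x < 1"
    by simp
  from AE_H_imp_of_AE_conditional[OF i _ this[unfolded D_def]] show ?thesis
    by simp
qed

lemma AE_pvalues_less_1_nulls_pos:
  "AE \<omega> in M. \<forall>i\<in>{1..m}. p_vec m P \<omega> i < 1 \<and> (\<not> h_vec m H \<omega> i \<longrightarrow> 0 < p_vec m P \<omega> i)"
proof (intro AE_finite_allI)
  fix i assume i: "i \<in> {1..m}"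
  show "AE \<omega> in M. p_vec m P \<omega> i < 1 \<and> (\<not> h_vec m H \<omega> i \<longrightarrow> 0 < p_vec m P \<omega> i)"
    using AE_null_pvalue_in_unit_interval[OF i] AE_alternative_pvalue_less_1[OF i]
    by eventually_elim (use i in \<open>auto simp: p_vec_def h_vec_def\<close>)
qed simp

text \<open>
  Every further claim is implied by the coverage of the indicators, up to null events.
\<close>

lemma coverage_of_consequence:
  assumes tests: "\<forall>k>0. uniformity_test \<alpha> k (\<phi> k)" and test0: "\<not> \<phi> 0 []" and "0 < \<alpha>"
    and Q: "\<And>h. h \<in> {1..m} \<rightarrow>\<^sub>E UNIV \<Longrightarrow> Measurable.pred (pvalue_space m) (Q h)"
    and imp: "AE \<omega> in M. h_vec m H \<omega> \<in> conf_indicators \<phi> m (p_vec m P \<omega>) \<longrightarrow>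
      Q (h_vec m H \<omega>) (p_vec m P \<omega>)"
  shows "1 - \<alpha> \<le> prob {\<omega> \<in> space M. Q (h_vec m H \<omega>) (p_vec m P \<omega>)}"
proof -
  have "1 - \<alpha> \<le> prob {\<omega> \<in> space M. h_vec m H \<omega> \<in> conf_indicators \<phi> m (p_vec m P \<omega>)}"
    using tests test0 \<open>0 < \<alpha>\<close> by (rule indicators_coverage)
  also have "\<dots> \<le> prob {\<omega> \<in> space M. Q (h_vec m H \<omega>) (p_vec m P \<omega>)}"
    using imp by (intro finite_measure_mono_AE sets_indicators_pvalues_event Q) auto
  finally show ?thesis .
qed

end

section \<open>Confidence sets, envelopes and thresholds\<close>

lemma countable_rational_thresholds: "countable (\<rat> \<inter> {0..1} :: real set)"
  using countable_rat by blast

lemma restrict_eq_iff: "(\<lambda>t\<in>A. f t) = (\<lambda>t\<in>A. g t) \<longleftrightarrow> (\<forall>t\<in>A. f t = g t)"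
  by (metis restrict_apply' restrict_ext)

locale tested_two_groups = two_groups +
  fixes \<alpha> c :: real and \<phi> :: "nat \<Rightarrow> real list \<Rightarrow> bool"
  assumes alpha_pos: "0 < \<alpha>" and c_nonneg: "0 \<le> c"
    and tests: "\<forall>k>0. uniformity_test \<alpha> k (\<phi> k)" and test0: "\<not> \<phi> 0 []"
begin

lemmas coverage = coverage_of_consequence[OF tests test0 alpha_pos]

lemma pred_conf [measurable]:
  "Measurable.pred (pvalue_space m) (\<lambda>p. h \<in> conf_indicators \<phi> m p)"
  using tests test0 by (rule pred_mem_conf_indicators)

lemma meas_fdp [measurable]: "(\<lambda>p. fdp m t h p) \<in> borel_measurable (pvalue_space m)"
  by (intro measurable_fdp) simp

lemma null_counts_coverage:
  "1 - \<alpha> \<le> prob {\<omega> \<in> space M. m0 m (h_vec m H \<omega>) \<in> conf_null_counts \<phi> m (p_vec m P \<omega>)}"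
proof (rule coverage)
  fix h :: "nat \<Rightarrow> bool"
  have "(\<lambda>p. m0 m h \<in> conf_null_counts \<phi> m p)
      = (\<lambda>p. \<exists>h'\<in>{1..m} \<rightarrow>\<^sub>E UNIV. h' \<in> conf_indicators \<phi> m p \<and> m0 m h = m0 m h')"
    by (auto simp: conf_null_counts_def conf_indicators_def fun_eq_iff)
  moreover have "Measurable.pred (pvalue_space m)
      (\<lambda>p. \<exists>h'\<in>{1..m} \<rightarrow>\<^sub>E UNIV. h' \<in> conf_indicators \<phi> m p \<and> m0 m h = m0 m h')"
    by (intro pred_intros_finite finite_indicators) measurable
  ultimately show "Measurable.pred (pvalue_space m) (\<lambda>p. m0 m h \<in> conf_null_counts \<phi> m p)"
    by simp
qed (simp add: conf_null_counts_def)

lemma fdp_coverage: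
  "1 - \<alpha> \<le> prob {\<omega> \<in> space M. (\<lambda>t\<in>{0..1}. fdp m t (h_vec m H \<omega>) (p_vec m P \<omega>))
      \<in> conf_fdps \<phi> m (p_vec m P \<omega>)}"
proof (rule coverage[of "\<lambda>h p. (\<lambda>t\<in>{0..1}. fdp m t h p) \<in> conf_fdps \<phi> m p"])
  fix h :: "nat \<Rightarrow> bool"
  have "(\<lambda>t\<in>{0..1}. fdp m t h p) = (\<lambda>t\<in>{0..1}. fdp m t h' p)
      \<longleftrightarrow> (\<forall>t\<in>\<rat> \<inter> {0..1}. fdp m t h p = fdp m t h' p)" for p h'
  proof -
    have "(\<lambda>t\<in>{0..1}. fdp m t h p) = (\<lambda>t\<in>{0..1}. fdp m t h' p)
        \<longleftrightarrow> (\<forall>t\<in>{0..1}. fdp m t h p = fdp m t h' p)"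
      by (rule restrict_eq_iff)
    also have "\<dots> \<longleftrightarrow> (\<forall>t\<in>\<rat> \<inter> {0..1}. fdp m t h p = fdp m t h' p)"
    proof (rule ball_threshold_iff_rational[of m p])
      fix t s :: real
      assume ts: "t \<in> {0..1}" "s \<in> {0..1}"
        and same: "\<And>i. i \<in> {1..m} \<Longrightarrow> p i \<le> t \<longleftrightarrow> p i \<le> s"
      have "fdp m t g p = fdp m s g p" for g
        using same by (rule fdp_cong_rejections)
      then show "fdp m t h p = fdp m t h' p \<longleftrightarrow> fdp m s h p = fdp m s h' p"
        by simp
    qed
    finally show ?thesis .
  qed
  then have "(\<lambda>p. (\<lambda>t\<in>{0..1}. fdp m t h p) \<in> conf_fdps \<phi> m p)
      = (\<lambda>p. \<exists>h'\<in>{1..m} \<rightarrow>\<^sub>E UNIV. h' \<in> conf_indicators \<phi> m p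
          \<and> (\<forall>t\<in>\<rat> \<inter> {0..1}. fdp m t h p = fdp m t h' p))"
    by (auto simp: conf_fdps_def conf_indicators_def fun_eq_iff[of "\<lambda>p. _ p \<in> _ p"] image_iff)
  moreover have "Measurable.pred (pvalue_space m)
      (\<lambda>p. \<exists>h'\<in>{1..m} \<rightarrow>\<^sub>E UNIV. h' \<in> conf_indicators \<phi> m p
          \<and> (\<forall>t\<in>\<rat> \<inter> {0..1}. fdp m t h p = fdp m t h' p))"
  proof (intro pred_intros_finite(4) finite_indicators pred_intros_logic(3) pred_conf
      measurable_pred_countable countable_rational_thresholds)
    fix t h'
    show "Measurable.pred (pvalue_space m) (\<lambda>p. fdp m t h p = fdp m t h' p)"
      unfolding pred_def by (intro borel_measurable_eq meas_fdp)
  qed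
  ultimately show "Measurable.pred (pvalue_space m)
      (\<lambda>p. (\<lambda>t\<in>{0..1}. fdp m t h p) \<in> conf_fdps \<phi> m p)"
    by simp
qed (simp add: conf_fdps_def)

lemma ceiling_set_coverage:
  "1 - \<alpha> \<le> prob {\<omega> \<in> space M. \<forall>t\<in>ceiling_set \<phi> m c (p_vec m P \<omega>).
      fdp m t (h_vec m H \<omega>) (p_vec m P \<omega>) \<le> c}"
proof (rule coverage[of "\<lambda>h p. \<forall>t\<in>ceiling_set \<phi> m c p. fdp m t h p \<le> c"])
  fix h :: "nat \<Rightarrow> bool"
  have "(\<forall>t\<in>ceiling_set \<phi> m c p. fdp m t h p \<le> c)
      \<longleftrightarrow> (\<forall>t\<in>\<rat> \<inter> {0..1}. t \<in> ceiling_set \<phi> m c p \<longrightarrow> fdp m t h p \<le> c)" for p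
  proof -
    have "(\<forall>t\<in>ceiling_set \<phi> m c p. fdp m t h p \<le> c)
        \<longleftrightarrow> (\<forall>t\<in>{0..1}. t \<in> ceiling_set \<phi> m c p \<longrightarrow> fdp m t h p \<le> c)"
      by (auto simp: ceiling_set_def)
    also have "\<dots> \<longleftrightarrow> (\<forall>t\<in>\<rat> \<inter> {0..1}. t \<in> ceiling_set \<phi> m c p \<longrightarrow> fdp m t h p \<le> c)"
    proof (rule ball_threshold_iff_rational[of m p])
      fix t s :: real
      assume ts: "t \<in> {0..1}" "s \<in> {0..1}"
        and same: "\<And>i. i \<in> {1..m} \<Longrightarrow> p i \<le> t \<longleftrightarrow> p i \<le> s"
      have "fdp m t h p = fdp m s h p"
        using same by (rule fdp_cong_rejections)
      moreover have "t \<in> ceiling_set \<phi> m c p \<longleftrightarrow> s \<in> ceiling_set \<phi> m c p"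
        using ceiling_set_cong_rejections[of t \<phi> m c p s] ceiling_set_cong_rejections[of s \<phi> m c p t]
          ts same by blast
      ultimately show "(t \<in> ceiling_set \<phi> m c p \<longrightarrow> fdp m t h p \<le> c)
          \<longleftrightarrow> (s \<in> ceiling_set \<phi> m c p \<longrightarrow> fdp m s h p \<le> c)"
        by simp
    qed
    finally show ?thesis .
  qed
  moreover have "Measurable.pred (pvalue_space m)
      (\<lambda>p. \<forall>t\<in>\<rat> \<inter> {0..1}. t \<in> ceiling_set \<phi> m c p \<longrightarrow> fdp m t h p \<le> c)"
  proof -
    note [measurable] = pred_mem_ceiling_set[OF pred_conf]
    show ?thesis
      by (intro measurable_pred_countable countable_rational_thresholds) measurable
  qed
  ultimately show "Measurable.pred (pvalue_space m)
      (\<lambda>p. \<forall>t\<in>ceiling_set \<phi> m c p. fdp m t h p \<le> c)"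
    by simp
qed (simp add: ceiling_set_def)

lemma fdp_left_ceiling_threshold_coverage:
  "1 - \<alpha> \<le> prob {\<omega> \<in> space M. fdp_left m (ceiling_threshold \<phi> m c (p_vec m P \<omega>))
      (h_vec m H \<omega>) (p_vec m P \<omega>) \<le> c}"
proof (rule coverage[of "\<lambda>h p. fdp_left m (ceiling_threshold \<phi> m c p) h p \<le> c"])
  fix h :: "nat \<Rightarrow> bool"
  have [measurable]: "(\<lambda>p. fdp_left m (ceiling_threshold \<phi> m c p) h p) \<in> borel_measurable (pvalue_space m)"
    by (intro measurable_fdp_left measurable_ceiling_threshold pred_conf)
  show "Measurable.pred (pvalue_space m) (\<lambda>p. fdp_left m (ceiling_threshold \<phi> m c p) h p \<le> c)"
    by measurable
next
  show "AE \<omega> in M. h_vec m H \<omega> \<in> conf_indicators \<phi> m (p_vec m P \<omega>) \<longrightarrow>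
      fdp_left m (ceiling_threshold \<phi> m c (p_vec m P \<omega>)) (h_vec m H \<omega>) (p_vec m P \<omega>) \<le> c"
    using AE_pvalues_less_1_nulls_pos
    by eventually_elim (intro impI fdp_left_ceiling_threshold_le c_nonneg, auto)
qed

lemma envelope_coverage:
  "1 - \<alpha> \<le> prob {\<omega> \<in> space M. \<forall>t\<in>{0..1}.
      fdp m t (h_vec m H \<omega>) (p_vec m P \<omega>) \<le> fdp_envelope \<phi> m (p_vec m P \<omega>) t}"
proof (rule coverage[of "\<lambda>h p. \<forall>t\<in>{0..1}. fdp m t h p \<le> fdp_envelope \<phi> m p t"])
  fix h :: "nat \<Rightarrow> bool"
  have "(\<forall>t\<in>{0..1}. fdp m t h p \<le> fdp_envelope \<phi> m p t)
      \<longleftrightarrow> (\<forall>t\<in>\<rat> \<inter> {0..1}. fdp m t h p \<le> fdp_envelope \<phi> m p t)" for p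
  proof (rule ball_threshold_iff_rational[of m p])
    fix t s :: real
    assume ts: "t \<in> {0..1}" "s \<in> {0..1}"
      and same: "\<And>i. i \<in> {1..m} \<Longrightarrow> p i \<le> t \<longleftrightarrow> p i \<le> s"
    have "fdp m t h p = fdp m s h p"
      using same by (rule fdp_cong_rejections)
    moreover have "fdp_envelope \<phi> m p t = fdp_envelope \<phi> m p s"
      using ts same by (rule fdp_envelope_cong_rejections)
    ultimately show "fdp m t h p \<le> fdp_envelope \<phi> m p t \<longleftrightarrow> fdp m s h p \<le> fdp_envelope \<phi> m p s"
      by simp
  qed
  moreover have "Measurable.pred (pvalue_space m)
      (\<lambda>p. \<forall>t\<in>\<rat> \<inter> {0..1}. fdp m t h p \<le> fdp_envelope \<phi> m p t)"
  proof (intro measurable_pred_countable countable_rational_thresholds)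
    fix t :: real assume "t \<in> \<rat> \<inter> {0..1}"
    then have envelope: "(\<lambda>p. fdp_envelope \<phi> m p t) \<in> borel_measurable (pvalue_space m)"
      by (intro measurable_fdp_envelope pred_conf test0) simp
    show "Measurable.pred (pvalue_space m) (\<lambda>p. fdp m t h p \<le> fdp_envelope \<phi> m p t)"
      unfolding pred_def by (intro borel_measurable_le meas_fdp envelope)
  qed
  ultimately show "Measurable.pred (pvalue_space m)
      (\<lambda>p. \<forall>t\<in>{0..1}. fdp m t h p \<le> fdp_envelope \<phi> m p t)"
    by simp
qed (auto intro: fdp_le_fdp_envelope)

lemma envelope_is_confidence_envelope:
  "confidence_envelope M \<alpha> (\<lambda>t \<omega>. fdp m t (h_vec m H \<omega>) (p_vec m P \<omega>))
     (\<lambda>t \<omega>. fdp_envelope \<phi> m (p_vec m P \<omega>) t)"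
  unfolding confidence_envelope_def
  using envelope_coverage
    measurable_compose[OF measurable_p_vec measurable_fdp_envelope[where \<phi> = \<phi>, OF pred_conf test0]]
  by simp

lemma ceiling_threshold_is_rate_ceiling_threshold:
  "rate_ceiling_threshold M m \<alpha> (p_vec m P)
     (\<lambda>t \<omega>. fdp_left m t (h_vec m H \<omega>) (p_vec m P \<omega>)) (ceiling_threshold \<phi> m c) c"
  unfolding rate_ceiling_threshold_def
  using fdp_left_ceiling_threshold_coverage measurable_ceiling_threshold[where \<phi> = \<phi> and c = c, OF pred_conf]
  by simp

end

lemma alternative_cdf_uniform: "alternative_cdf (\<lambda>t. max 0 (min 1 t))"
proof -
  have "continuous (at_right t) (\<lambda>t::real. max 0 (min 1 t))" for t
    by (intro continuous_max continuous_min continuous_const continuous_ident)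
  then show ?thesis
    unfolding alternative_cdf_def by (auto intro!: monoI)
qed

theorem theorem6p3:
  fixes \<alpha> c :: real and m :: nat and \<phi> :: "nat \<Rightarrow> real list \<Rightarrow> bool"
  assumes "0 < \<alpha>" "\<alpha> < 1" "0 < c" "c < 1" "m > 0"
    and tests: "\<forall>k>0. uniformity_test \<alpha> k (\<phi> k)"
    and test0: "\<not> \<phi> 0 []"
  shows
    "(\<forall>a F (M :: 'w measure) P H.
        0 < a \<and> a < 1 \<and> alternative_cdf F \<and> two_groups_model M m a F P H \<longrightarrow>
          measure M {\<omega> \<in> space M. h_vec m H \<omega> \<in> conf_indicators \<phi> m (p_vec m P \<omega>)} \<ge> 1 - \<alpha>
        \<and> measure M {\<omega> \<in> space M. m0 m (h_vec m H \<omega>) \<in> conf_null_counts \<phi> m (p_vec m P \<omega>)} \<ge> 1 - \<alpha>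
        \<and> measure M {\<omega> \<in> space M.
              (\<lambda>t\<in>{0..1}. fdp m t (h_vec m H \<omega>) (p_vec m P \<omega>)) \<in> conf_fdps \<phi> m (p_vec m P \<omega>)} \<ge> 1 - \<alpha>
        \<and> measure M {\<omega> \<in> space M. \<forall>t\<in>ceiling_set \<phi> m c (p_vec m P \<omega>).
              fdp m t (h_vec m H \<omega>) (p_vec m P \<omega>) \<le> c} \<ge> 1 - \<alpha>
        \<and> measure M {\<omega> \<in> space M. fdp_left m (ceiling_threshold \<phi> m c (p_vec m P \<omega>))
              (h_vec m H \<omega>) (p_vec m P \<omega>) \<le> c} \<ge> 1 - \<alpha>
        \<and> confidence_envelope M \<alpha> (\<lambda>t \<omega>. fdp m t (h_vec m H \<omega>) (p_vec m P \<omega>))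
              (\<lambda>t \<omega>. fdp_envelope \<phi> m (p_vec m P \<omega>) t)
        \<and> rate_ceiling_threshold M m \<alpha> (p_vec m P)
              (\<lambda>t \<omega>. fdp_left m t (h_vec m H \<omega>) (p_vec m P \<omega>)) (ceiling_threshold \<phi> m c) c)
     \<and> (\<forall>(M :: real \<Rightarrow> (real \<Rightarrow> real) \<Rightarrow> 'w measure) P H.
        (\<forall>a F. 0 < a \<and> a < 1 \<and> alternative_cdf F \<longrightarrow> two_groups_model (M a F) m a F P H) \<longrightarrow>
          (INF (a, F)\<in>{(a, F). 0 < a \<and> a < 1 \<and> alternative_cdf F}.
             measure (M a F) {\<omega> \<in> space (M a F). \<forall>t\<in>{0..1}.
               fdp m t (h_vec m H \<omega>) (p_vec m P \<omega>) \<le> fdp_envelope \<phi> m (p_vec m P \<omega>) t}) \<ge> 1 - \<alpha>)"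
    (is "?all \<and> ?inf")
proof
  have tested: "tested_two_groups M m a F P H \<alpha> c \<phi>"
    if "0 < a" "a < 1" "alternative_cdf F" "two_groups_model M m a F P H"
    for a F P H and M :: "'w measure"
    using that assms by unfold_locales auto
  show ?all
  proof (intro allI impI)
    fix a F P H and M :: "'w measure"
    assume "0 < a \<and> a < 1 \<and> alternative_cdf F \<and> two_groups_model M m a F P H"
    then interpret tested_two_groups M m a F P H \<alpha> c \<phi>
      using tested by blast
    show "measure M {\<omega> \<in> space M. h_vec m H \<omega> \<in> conf_indicators \<phi> m (p_vec m P \<omega>)} \<ge> 1 - \<alpha>
        \<and> measure M {\<omega> \<in> space M. m0 m (h_vec m H \<omega>) \<in> conf_null_counts \<phi> m (p_vec m P \<omega>)} \<ge> 1 - \<alpha>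
        \<and> measure M {\<omega> \<in> space M.
              (\<lambda>t\<in>{0..1}. fdp m t (h_vec m H \<omega>) (p_vec m P \<omega>)) \<in> conf_fdps \<phi> m (p_vec m P \<omega>)} \<ge> 1 - \<alpha>
        \<and> measure M {\<omega> \<in> space M. \<forall>t\<in>ceiling_set \<phi> m c (p_vec m P \<omega>).
              fdp m t (h_vec m H \<omega>) (p_vec m P \<omega>) \<le> c} \<ge> 1 - \<alpha>
        \<and> measure M {\<omega> \<in> space M. fdp_left m (ceiling_threshold \<phi> m c (p_vec m P \<omega>))
              (h_vec m H \<omega>) (p_vec m P \<omega>) \<le> c} \<ge> 1 - \<alpha>
        \<and> confidence_envelope M \<alpha> (\<lambda>t \<omega>. fdp m t (h_vec m H \<omega>) (p_vec m P \<omega>))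
              (\<lambda>t \<omega>. fdp_envelope \<phi> m (p_vec m P \<omega>) t)
        \<and> rate_ceiling_threshold M m \<alpha> (p_vec m P)
              (\<lambda>t \<omega>. fdp_left m t (h_vec m H \<omega>) (p_vec m P \<omega>)) (ceiling_threshold \<phi> m c) c"
      by (intro conjI indicators_coverage[OF tests test0 alpha_pos] null_counts_coverage
          fdp_coverage ceiling_set_coverage fdp_left_ceiling_threshold_coverage
          envelope_is_confidence_envelope ceiling_threshold_is_rate_ceiling_threshold)
  qed
  show ?inf
  proof (intro allI impI)
    fix M :: "real \<Rightarrow> (real \<Rightarrow> real) \<Rightarrow> 'w measure" and P H
    assume model: "\<forall>a F. 0 < a \<and> a < 1 \<and> alternative_cdf F \<longrightarrow> two_groups_model (M a F) m a F P H"
    \<comment> \<open>The infimum of the empty set of reals is unspecified, so an admissible pair is needed;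
      under the uniform law, alternatives and nulls have the same distribution.\<close>
    have "(1/2, \<lambda>t. max 0 (min 1 t)) \<in> {(a, F). 0 < a \<and> a < (1::real) \<and> alternative_cdf F}"
      using alternative_cdf_uniform by simp
    then have "{(a, F). 0 < a \<and> a < (1::real) \<and> alternative_cdf F} \<noteq> {}"
      by blast
    then show "1 - \<alpha> \<le> (INF (a, F)\<in>{(a, F). 0 < a \<and> a < 1 \<and> alternative_cdf F}.
             measure (M a F) {\<omega> \<in> space (M a F). \<forall>t\<in>{0..1}.
               fdp m t (h_vec m H \<omega>) (p_vec m P \<omega>) \<le> fdp_envelope \<phi> m (p_vec m P \<omega>) t})"
    proof (rule cINF_greatest)
      fix x :: "real \<times> (real \<Rightarrow> real)"
      assume "x \<in> {(a, F). 0 < a \<and> a < 1 \<and> alternative_cdf F}"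
      then obtain a F where x: "x = (a, F)" and aF: "0 < a" "a < 1" "alternative_cdf F"
        by blast
      from aF model have "two_groups_model (M a F) m a F P H"
        by blast
      from tested_two_groups.envelope_coverage[OF tested[OF aF this]]
      show "1 - \<alpha> \<le> (case x of (a, F) \<Rightarrow> measure (M a F) {\<omega> \<in> space (M a F). \<forall>t\<in>{0..1}.
          fdp m t (h_vec m H \<omega>) (p_vec m P \<omega>) \<le> fdp_envelope \<phi> m (p_vec m P \<omega>) t})"
        by (simp add: x)
    qed
  qed
qed

end
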